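(* Let $M_t\ge 1$ and $N\ge 1$ be fixed integers and let $\rho>0$ be a fixed real number. For each integer $K> N$, let $X_1,\dots,X_K$ be i.i.d. exponential random variables with mean $\rho$, let $X_{(1)}^{K}=\max_{1\le i\le K}X_i$, let $r_{th,N}=\rho\ln(K/N)$, and define the sum rate of the multi-threshold feedback scheme by $$R(K,N)= M_{t}\,P\{r_{th,N}\le X_{(1)}^{K}<\infty\}\;\mathbb{E}\left\{\log(1+X_{(1)}^{K}) \,\middle|\, r_{th,N}\le X_{(1)}^{K}<\infty\right\} + M_{t}\,P\{0\le X_{(1)}^{K}<r_{th,N}\}\;\mathbb{E}\left\{\log(1+X_{k}) \,\middle|\, 0\le X_{(1)}^{K}<r_{th,N}\right\},$$ where $k\in\{1,\dots,K\}$ is any fixed index (the value does not depend on $k$ by symmetry). Then $$\lim_{K\to\infty}\frac{R(K,N)}{M_t\log\log K}=1-e^{-N}.$$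
   Context: Here $\log$ is the logarithm with base $2$ and $\ln$ the natural logarithm. Interpretation: $X_i$ is the received signal-to-noise ratio of user $i$ on a given transmit beam, in a downlink system with $M_t$ beams, $K$ users, each with as many receive antennas as the base station has transmit antennas, and zero-forcing receivers under i.i.d. Rayleigh fading; in this case $X_i$ has cumulative distribution function $1-e^{-x/\rho}$ for $x>0$. A user feeds back only if its SNR is at least the lowest threshold $r_{th,N}$. If at least one user feeds back, the user with the largest SNR is scheduled; otherwise an arbitrary (random) user $k$ is scheduled. *)

theory Defs
  imports "HOL-Probability.Probability"
begin

text \<open>
  Elementary conditional expectation given an event of positive probability: the expectation
  under the conditional distribution \<open>B \<mapsto> P(A \<inter> B) / P(A)\<close>.  (The library's
  \<open>real_cond_exp\<close> conditions on a sub-sigma-algebra instead.)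
\<close>
definition event_expectation :: "'a measure \<Rightarrow> ('a \<Rightarrow> real) \<Rightarrow> ('a \<Rightarrow> bool) \<Rightarrow> real" where
  "event_expectation M f P = (LINT \<omega>|uniform_measure M {\<omega> \<in> space M. P \<omega>}. f \<omega>)"

definition lowest_threshold :: "real \<Rightarrow> nat \<Rightarrow> nat \<Rightarrow> real" where
  "lowest_threshold \<rho> K N = \<rho> * ln (real K / real N)"

definition max_snr :: "(nat \<Rightarrow> 'a \<Rightarrow> real) \<Rightarrow> nat \<Rightarrow> 'a \<Rightarrow> real" where
  "max_snr X K \<omega> = (MAX i\<in>{1..K}. X i \<omega>)"

text \<open>
  \<open>Mt\<close> is the number of beams and \<open>k\<close> the user scheduled when nobody feeds back.  The random
  variables are real-valued, so the upper bound \<open>\<infinity>\<close> on the largest SNR needs no mention.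
\<close>
definition sum_rate ::
  "'a measure \<Rightarrow> (nat \<Rightarrow> 'a \<Rightarrow> real) \<Rightarrow> real \<Rightarrow> nat \<Rightarrow> nat \<Rightarrow> nat \<Rightarrow> nat \<Rightarrow> real" where
  "sum_rate M X \<rho> Mt k K N =
     (let r = lowest_threshold \<rho> K N in
        real Mt * \<P>(\<omega> in M. r \<le> max_snr X K \<omega>)
          * event_expectation M (\<lambda>\<omega>. log 2 (1 + max_snr X K \<omega>)) (\<lambda>\<omega>. r \<le> max_snr X K \<omega>)
      + real Mt * \<P>(\<omega> in M. 0 \<le> max_snr X K \<omega> \<and> max_snr X K \<omega> < r)
          * event_expectation M (\<lambda>\<omega>. log 2 (1 + X k \<omega>))
              (\<lambda>\<omega>. 0 \<le> max_snr X K \<omega> \<and> max_snr X K \<omega> < r))"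

end

theory Submission
  imports Defs "HOL-Real_Asymp.Real_Asymp"
begin

text \<open>
  On the event that somebody feeds back, \<open>log (1 + X\<^sub>(\<^sub>1\<^sub>))\<close> is at least \<open>log (1 + r)\<close>, and by concavity it
  exceeds \<open>log (1 + r)\<close> by at most \<open>(X\<^sub>(\<^sub>1\<^sub>) - r) / ln 2 \<le> (\<Sum>i. max 0 (X\<^sub>i - r)) / ln 2\<close>.  The threshold is chosen so
  that the expectation of this sum is the constant \<open>K \<rho> exp (- r / \<rho>) = \<rho> N\<close>.  The event that nobody feeds
  back contributes at most \<open>E (log (1 + X\<^sub>k)) \<le> \<rho> / ln 2\<close>.  Hence the rate per beam is
  \<open>log (1 + r) (1 - (1 - N / K) ^ K) + O(1)\<close>, where \<open>log (1 + r)\<close> is asymptotic to \<open>log (log K)\<close>.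
\<close>

section \<open>Conditional expectation given an event\<close>

text \<open>The normalising factor of the conditional law cancels, so each summand of the rate
  becomes an unconditional integral over its event, which can be estimated pointwise.\<close>

lemma (in prob_space) prob_times_event_expectation:
  assumes [measurable]: "f \<in> borel_measurable M" and [measurable]: "{\<omega> \<in> space M. P \<omega>} \<in> events"
  shows "\<P>(\<omega> in M. P \<omega>) * event_expectation M f P
    = expectation (\<lambda>\<omega>. indicator {\<omega> \<in> space M. P \<omega>} \<omega> * f \<omega>)"
proof -
  define A where "A = {\<omega> \<in> space M. P \<omega>}"
  have [measurable]: "A \<in> events" using assms(2) by (simp add: A_def)
  show ?thesis
  proof (cases "prob A = 0")
    \<comment> \<open>On a null event the left side is 0 whatever value the conditional expectation
      takes, and the integrand on the right vanishes almost surely.\<close>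
    case True
    then have "AE \<omega> in M. \<omega> \<notin> A"
      by (simp add: prob_eq_0)
    then have "expectation (\<lambda>\<omega>. indicator A \<omega> * f \<omega>) = expectation (\<lambda>\<omega>. 0)"
      by (intro integral_cong_AE) auto
    with True show ?thesis by (simp add: A_def)
  next
    case False
    then have pos: "prob A > 0" by (simp add: zero_less_measure_iff)
    have "uniform_measure M A = density M (\<lambda>\<omega>. ennreal (indicator A \<omega> / prob A))"
      unfolding uniform_measure_def using pos
      by (intro density_cong) (auto simp: emeasure_eq_measure divide_ennreal
        simp flip: ennreal_indicator)
    then have "event_expectation M f P = expectation (\<lambda>\<omega>. (indicator A \<omega> / prob A) *\<^sub>R f \<omega>)"
      unfolding event_expectation_def A_def[symmetric] by (simp add: integral_density)
    also have "\<dots> = expectation (\<lambda>\<omega>. (indicator A \<omega> * f \<omega>) / prob A)"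
      by simp
    \<comment> \<open>If the integrand is not integrable, both integrals take the default value
      0.\<close>
    also have "\<dots> = expectation (\<lambda>\<omega>. indicator A \<omega> * f \<omega>) / prob A"
      by (rule integral_divide_zero)
    finally show ?thesis using pos by (simp add: A_def)
  qed
qed

section \<open>Tails of the exponential law\<close>

text \<open>Memorylessness: given \<open>X > r\<close>, the excess \<open>X - r\<close> is again
  exponential with rate \<open>l\<close> and mean \<open>1 / l\<close>, and the event itself has
  probability \<open>exp (- r * l)\<close>.\<close>

lemma (in prob_space) has_bochner_integral_exponential_excess:
  assumes D: "distributed M lborel X (exponential_density l)" and l: "0 < l" and r: "0 \<le> r"
  shows "has_bochner_integral M (\<lambda>\<omega>. max 0 (X \<omega> - r)) (exp (- r * l) / l)"
proof (rule has_bochner_integral_nn_integral)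
  have [measurable]: "X \<in> borel_measurable M"
    using distributed_measurable[OF D] by simp
  show "(\<lambda>\<omega>. max 0 (X \<omega> - r)) \<in> borel_measurable M" by simp
  have "(\<integral>\<^sup>+\<omega>. ennreal (max 0 (X \<omega> - r)) \<partial>M)
      = (\<integral>\<^sup>+x. ennreal (exponential_density l x) * ennreal (max 0 (x - r)) \<partial>lborel)"
    by (subst distributed_nn_integral[OF D]) auto
  also have "\<dots> = (\<integral>\<^sup>+x. ennreal (exponential_density l (r + 1 * x))
      * ennreal (max 0 ((r + 1 * x) - r)) \<partial>lborel)"
    by (subst nn_integral_real_affine[where c = 1 and t = r]) auto
  \<comment> \<open>After the shift by \<open>r\<close> the density factorises for
    \<open>x \<ge> 0\<close>. For \<open>x < 0\<close> the cut-off kills the left side and the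
    density the right one.\<close>
  also have "\<dots> = (\<integral>\<^sup>+x. ennreal (exp (- r * l)) * ennreal (exponential_density l x * x ^ 1) \<partial>lborel)"
  proof (intro nn_integral_cong)
    fix x :: real
    show "ennreal (exponential_density l (r + 1 * x)) * ennreal (max 0 ((r + 1 * x) - r))
        = ennreal (exp (- r * l)) * ennreal (exponential_density l x * x ^ 1)"
      using l r
      by (cases "x < 0")
        (auto simp: exponential_density_def algebra_simps exp_diff exp_minus exp_add field_simps
          simp flip: ennreal_mult)
  qed
  also have "\<dots> = ennreal (exp (- r * l)) * (\<integral>\<^sup>+x. ennreal (exponential_density l x * x ^ 1) \<partial>lborel)"
    by (rule nn_integral_cmult) simp
  also have "(\<integral>\<^sup>+x. ennreal (exponential_density l x * x ^ 1) \<partial>lborel) = ennreal (1 / l)"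
    using nn_integral_erlang_ith_moment[OF l, of 0 1] by simp
  also have "ennreal (exp (- r * l)) * ennreal (1 / l) = ennreal (exp (- r * l) / l)"
    using l by (simp flip: ennreal_mult)
  finally show "(\<integral>\<^sup>+\<omega>. ennreal (max 0 (X \<omega> - r)) \<partial>M) = ennreal (exp (- r * l) / l)" .
qed (use l in auto)

lemma (in prob_space) exponential_distributedD_less:
  assumes D: "distributed M lborel X (exponential_density l)" and l: "0 < l" and r: "0 \<le> r"
  shows "\<P>(\<omega> in M. X \<omega> < r) = 1 - exp (- r * l)"
proof -
  have [measurable]: "X \<in> borel_measurable M"
    using distributed_measurable[OF D] by simp
  have "AE \<omega> in M. X \<omega> \<noteq> r"
    using AE_lborel_singleton[of r] by (subst distributed_AE2[OF D]) auto
  then have "\<P>(\<omega> in M. X \<omega> < r) = \<P>(\<omega> in M. X \<omega> \<le> r)"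
    by (intro finite_measure_eq_AE) auto
  then show ?thesis
    using exponential_distributedD_le[OF D r l] by simp
qed

lemma (in prob_space) AE_exponential_distributed_nonneg:
  assumes D: "distributed M lborel X (exponential_density l)"
  shows "AE \<omega> in M. 0 \<le> X \<omega>"
  by (subst distributed_AE2[OF D]) (auto simp: exponential_density_def)

section \<open>Pointwise bounds for the logarithm and the maximum\<close>

text \<open>This is \<open>ln z \<le> z - 1\<close> at \<open>z = (1 + y) / (1 + r)\<close>; the
  tangent slope \<open>1 / (1 + r)\<close> is then weakened to 1.\<close>

lemma log2_le_linear:
  fixes r y :: real
  assumes "0 \<le> r" "r \<le> y"
  shows "log 2 (1 + y) \<le> log 2 (1 + r) + (y - r) / ln 2"
proof -
  have "ln (1 + y) - ln (1 + r) = ln ((1 + y) / (1 + r))"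
    using assms by (simp add: ln_div)
  also have "\<dots> \<le> (1 + y) / (1 + r) - 1"
    using assms by (intro ln_le_minus_one) simp
  also have "\<dots> = (y - r) / (1 + r)"
    using assms by (simp add: field_simps)
  also have "\<dots> \<le> (y - r) / 1"
    using assms by (intro divide_left_mono) auto
  finally have "ln (1 + y) \<le> ln (1 + r) + (y - r)" by simp
  then show ?thesis
    by (simp add: log_def divide_right_mono flip: add_divide_distrib)
qed

lemma max_snr_less_iff:
  assumes "K \<ge> 1"
  shows "max_snr X K \<omega> < r \<longleftrightarrow> (\<forall>i\<in>{1..K}. X i \<omega> < r)"
  unfolding max_snr_def using assms by (subst Max_less_iff) auto

text \<open>The maximum is attained at some index, and the other summands are nonnegative. The sum
  has an explicit expectation without any use of the law of the maximum.\<close>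

lemma max_snr_excess_le:
  assumes "K \<ge> 1"
  shows "max_snr X K \<omega> - r \<le> (\<Sum>i\<in>{1..K}. max 0 (X i \<omega> - r))"
proof -
  have "max_snr X K \<omega> \<in> (\<lambda>i. X i \<omega>) ` {1..K}"
    unfolding max_snr_def using assms by (intro Max_in) auto
  then obtain i where i: "i \<in> {1..K}" "max_snr X K \<omega> = X i \<omega>" by auto
  have "max 0 (X i \<omega> - r) \<le> (\<Sum>i\<in>{1..K}. max 0 (X i \<omega> - r))"
    using i(1) by (intro member_le_sum) auto
  with i(2) show ?thesis by simp
qed

section \<open>The two summands of the rate for a fixed number of users\<close>

text \<open>Here \<open>l\<close> is the rate, the inverse of the mean, and \<open>r\<close> is any
  nonnegative threshold; the particular choice enters only in
  \<open>sum_rate_bounds\<close>.\<close>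

locale iid_exponential = prob_space M for M :: "'a measure" +
  fixes X :: "nat \<Rightarrow> 'a \<Rightarrow> real" and K :: nat and l r :: real
  assumes K: "1 \<le> K" and l: "0 < l" and r: "0 \<le> r"
    and indep: "indep_vars (\<lambda>_. borel) X {1..K}"
    and D: "\<And>i. i \<in> {1..K} \<Longrightarrow> distributed M lborel (X i) (exponential_density l)"
begin

lemma X_measurable: "i \<in> {1..K} \<Longrightarrow> X i \<in> borel_measurable M"
  using distributed_measurable[OF D] by simp

lemma max_snr_measurable [measurable]: "max_snr X K \<in> borel_measurable M"
  unfolding max_snr_def[abs_def] by (intro borel_measurable_Max X_measurable) auto

lemma prob_max_snr_ge: "\<P>(\<omega> in M. r \<le> max_snr X K \<omega>) = 1 - (1 - exp (- r * l)) ^ K"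
proof -
  have "\<P>(\<omega> in M. max_snr X K \<omega> < r) = prob (\<Inter>i\<in>{1..K}. X i -` {..<r} \<inter> space M)"
    using K by (intro arg_cong[where f = prob]) (auto simp: max_snr_less_iff)
  also have "\<dots> = (\<Prod>i\<in>{1..K}. prob (X i -` {..<r} \<inter> space M))"
    using K by (intro indep_varsD_finite[OF indep]) auto
  also have "\<dots> = (\<Prod>i\<in>{1..K}. 1 - exp (- r * l))"
  proof (intro prod.cong refl)
    fix i assume i: "i \<in> {1..K}"
    have "X i -` {..<r} \<inter> space M = {\<omega> \<in> space M. X i \<omega> < r}" by auto
    then show "prob (X i -` {..<r} \<inter> space M) = 1 - exp (- r * l)"
      using exponential_distributedD_less[OF D[OF i] l r] by simp
  qed
  finally have "\<P>(\<omega> in M. max_snr X K \<omega> < r) = (1 - exp (- r * l)) ^ K" by simp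
  moreover have "\<P>(\<omega> in M. \<not> max_snr X K \<omega> < r) = 1 - \<P>(\<omega> in M. max_snr X K \<omega> < r)"
    by (intro prob_neg) measurable
  ultimately show ?thesis by (simp add: not_less)
qed

lemma feedback_term_bounds:
  defines "p \<equiv> \<P>(\<omega> in M. r \<le> max_snr X K \<omega>)"
    and "e \<equiv> event_expectation M (\<lambda>\<omega>. log 2 (1 + max_snr X K \<omega>)) (\<lambda>\<omega>. r \<le> max_snr X K \<omega>)"
  shows "log 2 (1 + r) * p \<le> p * e"
    and "p * e \<le> log 2 (1 + r) * p + real K * exp (- r * l) / (l * ln 2)"
proof -
  define A where "A = {\<omega> \<in> space M. r \<le> max_snr X K \<omega>}"
  define h where "h \<omega> = indicator A \<omega> * log 2 (1 + max_snr X K \<omega>)" for \<omega>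
  \<comment> \<open>An integrable majorant of \<open>h\<close>: the linear bound at
    \<open>r\<close>, with the excess of the maximum replaced by the sum of all positive
    excesses.\<close>
  define g where "g \<omega> = log 2 (1 + r) * indicator A \<omega>
    + (\<Sum>i\<in>{1..K}. max 0 (X i \<omega> - r)) / ln 2" for \<omega>
  have [measurable]: "A \<in> events" unfolding A_def by measurable
  have pe: "p * e = expectation h"
    unfolding p_def e_def h_def A_def by (intro prob_times_event_expectation) measurable
  have ind: "has_bochner_integral M (\<lambda>\<omega>. log 2 (1 + r) * indicator A \<omega>) (log 2 (1 + r) * p)"
    unfolding p_def A_def[symmetric]
    by (intro has_bochner_integral_mult_right has_bochner_integral_real_indicator)
       (auto simp: emeasure_eq_measure)
  have "has_bochner_integral M g
      (log 2 (1 + r) * p + (\<Sum>i\<in>{1..K}. exp (- r * l) / l) / ln 2)"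
    unfolding g_def
    by (intro has_bochner_integral_add ind has_bochner_integral_divide_zero
        has_bochner_integral_sum has_bochner_integral_exponential_excess D l r)
  then have g: "has_bochner_integral M g (log 2 (1 + r) * p + real K * exp (- r * l) / (l * ln 2))"
    by simp
  have lower: "log 2 (1 + r) * indicator A \<omega> \<le> h \<omega>" for \<omega>
    using r by (auto simp: h_def A_def split: split_indicator)
  have upper: "h \<omega> \<le> g \<omega>" for \<omega>
  proof (cases "\<omega> \<in> A")
    case True
    then have "log 2 (1 + max_snr X K \<omega>) \<le> log 2 (1 + r) + (max_snr X K \<omega> - r) / ln 2"
      using r by (intro log2_le_linear) (auto simp: A_def)
    also have "\<dots> \<le> log 2 (1 + r) + (\<Sum>i\<in>{1..K}. max 0 (X i \<omega> - r)) / ln 2"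
      by (intro add_left_mono divide_right_mono max_snr_excess_le K) simp
    finally show ?thesis using True by (simp add: h_def g_def)
  next
    case False
    then show ?thesis by (simp add: h_def g_def sum_nonneg)
  qed
  have h_int: "integrable M h"
  proof (rule Bochner_Integration.integrable_bound)
    show "integrable M g" using g by (rule integrable.intros)
    show "h \<in> borel_measurable M" unfolding h_def by measurable
    \<comment> \<open>Since \<open>r \<ge> 0\<close>, the lower bound makes \<open>h\<close>
      nonnegative, so \<open>upper\<close> also bounds absolute values.\<close>
    have "0 \<le> log 2 (1 + r) * indicator A \<omega>" for \<omega>
      using r by simp
    then have "\<bar>h \<omega>\<bar> \<le> \<bar>g \<omega>\<bar>" for \<omega>
      using lower[of \<omega>] upper[of \<omega>] by (smt (verit))
    then show "AE \<omega> in M. norm (h \<omega>) \<le> norm (g \<omega>)" by simp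
  qed
  show "log 2 (1 + r) * p \<le> p * e"
    unfolding pe has_bochner_integral_integral_eq[OF ind, symmetric]
    by (intro integral_mono integrable.intros[OF ind] h_int lower)
  show "p * e \<le> log 2 (1 + r) * p + real K * exp (- r * l) / (l * ln 2)"
    unfolding pe has_bochner_integral_integral_eq[OF g, symmetric]
    by (intro integral_mono integrable.intros[OF g] h_int upper)
qed

text \<open>A crude bound suffices: dropping the event and using
  \<open>log 2 (1 + x) \<le> x / ln 2\<close> leaves the mean \<open>1 / l\<close> divided by
  \<open>ln 2\<close>.\<close>

lemma no_feedback_term_bounds:
  fixes k :: nat
  assumes k: "k \<in> {1..K}"
  defines "p \<equiv> \<P>(\<omega> in M. 0 \<le> max_snr X K \<omega> \<and> max_snr X K \<omega> < r)"
    and "e \<equiv> event_expectation M (\<lambda>\<omega>. log 2 (1 + X k \<omega>))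
      (\<lambda>\<omega>. 0 \<le> max_snr X K \<omega> \<and> max_snr X K \<omega> < r)"
  shows "0 \<le> p * e" and "p * e \<le> 1 / (l * ln 2)"
proof -
  define A where "A = {\<omega> \<in> space M. 0 \<le> max_snr X K \<omega> \<and> max_snr X K \<omega> < r}"
  define h where "h \<omega> = indicator A \<omega> * log 2 (1 + X k \<omega>)" for \<omega>
  have [measurable]: "A \<in> events" "X k \<in> borel_measurable M"
    using k by (auto simp: A_def X_measurable)
  have pe: "p * e = expectation h"
    unfolding p_def e_def h_def A_def by (intro prob_times_event_expectation) measurable
  have X_int: "has_bochner_integral M (X k) (1 / l)"
    using has_bochner_integral_erlang_ith_moment[OF l D[OF k], of 1] by simp
  then have g: "has_bochner_integral M (\<lambda>\<omega>. X k \<omega> / ln 2) (1 / l / ln 2)"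
    by (rule has_bochner_integral_divide_zero)
  have nonneg: "AE \<omega> in M. 0 \<le> X k \<omega>"
    by (rule AE_exponential_distributed_nonneg[OF D[OF k]])
  \<comment> \<open>Only almost surely: a nonnegative maximum does not prevent \<open>X k\<close>
    from being negative on a null set.\<close>
  then have bounds: "AE \<omega> in M. 0 \<le> h \<omega> \<and> h \<omega> \<le> X k \<omega> / ln 2"
  proof eventually_elim
    case (elim \<omega>)
    then show ?case
      using log2_le_linear[of 0 "X k \<omega>"] by (auto simp: h_def split: split_indicator)
  qed
  show "0 \<le> p * e"
    unfolding pe using bounds by (intro integral_nonneg_AE) auto
  have h_int: "integrable M h"
  proof (rule Bochner_Integration.integrable_bound[OF integrable.intros[OF g]])
    show "h \<in> borel_measurable M" unfolding h_def by measurable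
    show "AE \<omega> in M. norm (h \<omega>) \<le> norm (X k \<omega> / ln 2)"
      using bounds by eventually_elim (simp only: real_norm_def, linarith)
  qed
  have "p * e \<le> 1 / l / ln 2"
    unfolding pe has_bochner_integral_integral_eq[OF g, symmetric]
    using bounds by (intro integral_mono_AE integrable.intros[OF g] h_int) auto
  then show "p * e \<le> 1 / (l * ln 2)" by simp
qed

end

text \<open>The gap between the bounds does not depend on \<open>K\<close>: feedback contributes
  \<open>\<rho> * N / ln 2\<close> to it and silence \<open>\<rho> / ln 2\<close>.\<close>

lemma sum_rate_bounds:
  fixes X :: "nat \<Rightarrow> 'a \<Rightarrow> real"
  assumes "1 \<le> N" "N < K" "0 < \<rho>" "prob_space M"
    and "prob_space.indep_vars M (\<lambda>_. borel) X {1..K}"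
    and "\<And>i. i \<in> {1..K} \<Longrightarrow> distributed M lborel (X i) (exponential_density (1 / \<rho>))"
    and k: "k \<in> {1..K}"
  defines "m \<equiv> log 2 (1 + lowest_threshold \<rho> K N) * (1 - (1 - real N / real K) ^ K)"
  shows "real Mt * m \<le> sum_rate M X \<rho> Mt k K N"
    and "sum_rate M X \<rho> Mt k K N \<le> real Mt * (m + \<rho> * (real N + 1) / ln 2)"
proof -
  define r where "r = lowest_threshold \<rho> K N"
  have r: "r \<ge> 0"
    using assms(1-3) by (simp add: r_def lowest_threshold_def)
  interpret prob_space M by fact
  interpret iid_exponential M X K "1 / \<rho>" r
    using assms r by unfold_locales auto
  \<comment> \<open>The threshold is tuned so that each user feeds back with probability
    \<open>N / K\<close>, hence \<open>N\<close> users on average.\<close>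
  have "exp (- r * (1 / \<rho>)) = exp (- ln (real K / real N))"
    using assms(3) by (simp add: r_def lowest_threshold_def)
  also have "\<dots> = real N / real K"
    using assms(1,2) by (simp add: exp_minus)
  finally have exp_r: "exp (- r * (1 / \<rho>)) = real N / real K" .
  have prob: "\<P>(\<omega> in M. r \<le> max_snr X K \<omega>) = 1 - (1 - real N / real K) ^ K"
    using prob_max_snr_ge unfolding exp_r .
  define s where "s = \<P>(\<omega> in M. r \<le> max_snr X K \<omega>)
    * event_expectation M (\<lambda>\<omega>. log 2 (1 + max_snr X K \<omega>)) (\<lambda>\<omega>. r \<le> max_snr X K \<omega>)"
  define t where "t = \<P>(\<omega> in M. 0 \<le> max_snr X K \<omega> \<and> max_snr X K \<omega> < r)
    * event_expectation M (\<lambda>\<omega>. log 2 (1 + X k \<omega>)) (\<lambda>\<omega>. 0 \<le> max_snr X K \<omega> \<and> max_snr X K \<omega> < r)"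
  have rate: "sum_rate M X \<rho> Mt k K N = real Mt * (s + t)"
    by (simp add: sum_rate_def Let_def s_def t_def r_def algebra_simps)
  have "m \<le> s"
    using feedback_term_bounds(1) unfolding m_def s_def r_def[symmetric] prob .
  moreover have "0 \<le> t"
    using no_feedback_term_bounds(1)[OF k] by (simp add: t_def)
  ultimately show "real Mt * m \<le> sum_rate M X \<rho> Mt k K N"
    unfolding rate by (intro mult_left_mono) auto
  have "s \<le> m + real K * (real N / real K) / (1 / \<rho> * ln 2)"
    using feedback_term_bounds(2) unfolding exp_r m_def s_def r_def[symmetric] prob .
  also have "\<dots> = m + \<rho> * real N / ln 2"
    using assms(2) by simp
  finally have "s \<le> m + \<rho> * real N / ln 2" .
  moreover have "t \<le> \<rho> / ln 2"
    using no_feedback_term_bounds(2)[OF k] by (simp add: t_def)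
  ultimately have "s + t \<le> m + \<rho> * (real N + 1) / ln 2"
    by (simp add: algebra_simps add_divide_distrib)
  then show "sum_rate M X \<rho> Mt k K N \<le> real Mt * (m + \<rho> * (real N + 1) / ln 2)"
    unfolding rate by (intro mult_left_mono) auto
qed

section \<open>Passage to the limit\<close>

theorem theorem1:
  fixes Mt N :: nat and \<rho> :: real
    and M :: "nat \<Rightarrow> 'a measure" and X :: "nat \<Rightarrow> nat \<Rightarrow> 'a \<Rightarrow> real" and k :: "nat \<Rightarrow> nat"
  assumes "Mt \<ge> 1" and "N \<ge> 1" and "\<rho> > 0"
    and "\<And>K. K > N \<Longrightarrow> prob_space (M K)"
    and "\<And>K. K > N \<Longrightarrow> prob_space.indep_vars (M K) (\<lambda>_. borel) (X K) {1..K}"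
    and "\<And>K i. K > N \<Longrightarrow> i \<in> {1..K} \<Longrightarrow>
           distributed (M K) lborel (X K i) (exponential_density (1 / \<rho>))"
    and "\<And>K. K > N \<Longrightarrow> k K \<in> {1..K}"
  shows "(\<lambda>K. sum_rate (M K) (X K) \<rho> Mt (k K) K N / (real Mt * log 2 (log 2 (real K))))
           \<longlonglongrightarrow> 1 - exp (- real N)"
proof -
  define L where "L K = log 2 (log 2 (real K))" for K
  define m where "m K = log 2 (1 + lowest_threshold \<rho> K N) * (1 - (1 - real N / real K) ^ K)" for K
  define c where "c = \<rho> * (real N + 1) / ln 2"
  \<comment> \<open>Dividing the bounds by \<open>L K\<close> needs its positivity, which is only
    eventual: \<open>L 2 = 0\<close>.\<close>
  have L_pos: "eventually (\<lambda>K. L K > 0) sequentially"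
    unfolding L_def by real_asymp
  have K_large: "eventually (\<lambda>K. K > N) sequentially"
    by (rule eventually_gt_at_top)
  \<comment> \<open>The threshold grows like a constant times \<open>log 2 K\<close>; the outer
    logarithm turns that constant into a bounded summand.\<close>
  have log_ratio: "(\<lambda>K. log 2 (1 + lowest_threshold \<rho> K N) / L K) \<longlonglongrightarrow> 1"
    using assms(2,3) unfolding lowest_threshold_def L_def by real_asymp
  have "(\<lambda>K. (1 + - real N / real K) ^ K) \<longlonglongrightarrow> exp (- real N)"
    by (rule tendsto_exp_limit_sequentially)
  then have "(\<lambda>K. log 2 (1 + lowest_threshold \<rho> K N) / L K * (1 - (1 - real N / real K) ^ K))
      \<longlonglongrightarrow> 1 * (1 - exp (- real N))"
    by (intro tendsto_intros log_ratio) simp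
  then have lower_lim: "(\<lambda>K. m K / L K) \<longlonglongrightarrow> 1 - exp (- real N)"
    by (simp add: m_def)
  \<comment> \<open>The constant gap is negligible against \<open>L K\<close>, so both bounds share
    one limit.\<close>
  have "(\<lambda>K. c / L K) \<longlonglongrightarrow> 0"
    unfolding L_def by real_asymp
  from tendsto_add[OF lower_lim this]
  have upper_lim: "(\<lambda>K. (m K + c) / L K) \<longlonglongrightarrow> 1 - exp (- real N)"
    by (simp add: add_divide_distrib)
  show ?thesis
    unfolding L_def[symmetric]
  proof (rule tendsto_sandwich[OF _ _ lower_lim upper_lim])
    show "eventually (\<lambda>K. m K / L K \<le> sum_rate (M K) (X K) \<rho> Mt (k K) K N / (real Mt * L K)) sequentially"
      using L_pos K_large
    proof eventually_elim
      case (elim K)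
      have "real Mt * m K \<le> sum_rate (M K) (X K) \<rho> Mt (k K) K N"
        unfolding m_def using elim assms by (intro sum_rate_bounds(1)) auto
      then have "real Mt * m K / (real Mt * L K) \<le> sum_rate (M K) (X K) \<rho> Mt (k K) K N / (real Mt * L K)"
        using elim by (intro divide_right_mono) auto
      then show ?case using assms(1) by simp
    qed
    show "eventually (\<lambda>K. sum_rate (M K) (X K) \<rho> Mt (k K) K N / (real Mt * L K) \<le> (m K + c) / L K) sequentially"
      using L_pos K_large
    proof eventually_elim
      case (elim K)
      have "sum_rate (M K) (X K) \<rho> Mt (k K) K N \<le> real Mt * (m K + c)"
        unfolding m_def c_def using elim assms by (intro sum_rate_bounds(2)) auto
      then have "sum_rate (M K) (X K) \<rho> Mt (k K) K N / (real Mt * L K) \<le> real Mt * (m K + c) / (real Mt * L K)"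
        using elim by (intro divide_right_mono) auto
      then show ?case using assms(1) by simp
    qed
  qed
qed

end
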